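(* Let $f_{\mathrm{base}}$ be a frozen $L$-layer decoder embedding model, let $\mathcal{M}$ be any finite set of packs (per-layer adapter stacks with binary gates $g_m$, $m\in\mathcal{M}$, and arbitrary adapter parameters), and let $f$ be the model obtained from $f_{\mathrm{base}}$ by attaching all the packs in $\mathcal{M}$ through their gated layer hooks. Then for every input $x$ with $g_m(x)=0$ for all $m\in\mathcal{M}$, the model $f$ executes on $x$ the same operations as $f_{\mathrm{base}}$, on the same weights, in the same order; hence $f(x)=f_{\mathrm{base}}(x)$ exactly.
   Context: Base model. $f_{\mathrm{base}}$ is a fixed (frozen) decoder model: an input $x$ is mapped by an input stage to hidden states $h_0\in\mathbb{R}^{n\times d}$ ($n$ depends on $x$), decoder layers $F_1,\dots,F_L$ are applied in order, $h_\ell=F_\ell(h_{\ell-1})$, and an output stage (pooling/readout) maps the final hidden states to the embedding $f_{\mathrm{base}}(x)$. (In the paper's instance $L=28$, $d=2048$.) All base weights are fixed and shared by every model considered. Adapters. A bottleneck adapter at layer $\ell$ of rank $r$ is the map, applied to each of the $n$ rows (viewed as column vectors in $\mathbb{R}^d$), $$A_\ell(h)=W^{\mathrm{up}}_\ell\,\sigma\bigl(W^{\mathrm{down}}_\ell\,\mathrm{LN}(h)\bigr),\qquad W^{\mathrm{down}}_\ell\in\mathbb{R}^{r\times d},\ W^{\mathrm{up}}_\ell\in\mathbb{R}^{d\times r},$$ where $\sigma$ is the SiLU nonlinearity and $\mathrm{LN}$ is a LayerNorm. Packs, gates, hooks. A pack $m$ consists of one such adapter $A^{(m)}_\ell$ for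 every layer $\ell=1,\dots,L$, with arbitrary parameter values (e.g. after arbitrary training), together with a binary gate $g_m(x)\in\{0,1\}$, which is a fixed function of the input $x$. Attaching pack $m$ registers at every layer $\ell$ a gated hook that is run on the layer's output $h_\ell$: if $g_m(x)=1$ the hook replaces $h_\ell$ by $h_\ell+A^{(m)}_\ell(h_\ell)$; if $g_m(x)=0$ the hook returns immediately, before performing any adapter operation, and $h_\ell$ is passed on unchanged. When several packs are attached, their hooks at a given layer are run one after another in a fixed registration order, each on the value left by the previous one, and the result is fed to layer $\ell+1$ (or to the output stage if $\ell=L$). The hooks are the only modifications made to the base model. Operations. The operations executed by a model on an input are the sequence of numerical operations on weights and activations (with their operands) actually carried out; evaluating a gate or returning early from a hook is not a numerical operation. Adapter operations of a pack $m$ are carried out only when $g_m(x)=1$. All models are run under the same fixed inference configuration (same precision, kernels and batch composition), so that each numerical operation is a deterministic function of its operands; "exactly" means equality of outputs, not approximate equality. *)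

theory Defs
  imports Complex_Main "Jordan_Normal_Form.Matrix"
begin

section \<open>Programs that execute numerical operations\<close>

text \<open>
  A numerical operation is a kernel together with its operands. A weight operand carries the
  identity of the stored parameter tensor (of type \<open>'p\<close>) in addition to its value, so that equality
  of operations includes acting on the same weights. \<open>Other\<close> covers the kernels of
  the base model that are not needed for adapters (attention, embedding lookup, pooling, ...).
\<close>

datatype 'k kernel = LayerNorm real | Linear | SiLU | Add | Other 'k

type_synonym 'p weight = "'p \<times> real mat"

datatype 'p operand = Weight "'p weight" | Activation "real mat"

primrec operand_value :: "'p operand \<Rightarrow> real mat" where
  "operand_value (Weight w) = snd w"
| "operand_value (Activation h) = h"

datatype ('k, 'p) operation = Operation "'k kernel" "'p operand list"

text \<open>
  An inference configuration (precision, kernel implementations, batch composition) enters only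
  through the result it gives to each kernel. Being a function of the operand values, this
  result is deterministic; it need not agree with exact real arithmetic.
\<close>

type_synonym 'k config = "'k kernel \<Rightarrow> real mat list \<Rightarrow> real mat"

text \<open>
  The continuation of \<open>Exec\<close> receives the result of the operation. Anything that is not an \<open>Exec\<close>
  (such as testing a gate) leaves no trace.
\<close>

datatype ('k, 'p, 'a) prog =
  Return 'a
| Exec "('k, 'p) operation" "real mat \<Rightarrow> ('k, 'p, 'a) prog"

primrec and_then :: "('k, 'p, 'a) prog \<Rightarrow> ('a \<Rightarrow> ('k, 'p, 'b) prog) \<Rightarrow> ('k, 'p, 'b) prog"
  (infixl "\<rhd>" 54) where
  "Return a \<rhd> f = f a"
| "Exec p k \<rhd> f = Exec p (\<lambda>v. k v \<rhd> f)"

definition call :: "'k kernel \<Rightarrow> 'p operand list \<Rightarrow> ('k, 'p, real mat) prog" where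
  "call c os = Exec (Operation c os) Return"

primrec perform :: "'k config \<Rightarrow> ('k, 'p) operation \<Rightarrow> real mat" where
  "perform K (Operation c os) = K c (map operand_value os)"

primrec operations :: "'k config \<Rightarrow> ('k, 'p, 'a) prog \<Rightarrow> ('k, 'p) operation list" where
  "operations K (Return a) = []"
| "operations K (Exec p k) = p # operations K (k (perform K p))"

primrec result :: "'k config \<Rightarrow> ('k, 'p, 'a) prog \<Rightarrow> 'a" where
  "result K (Return a) = a"
| "result K (Exec p k) = result K (k (perform K p))"


section \<open>Base model\<close>

text \<open>
  The stages are programs that already contain the (frozen) base weights as operands. Layers are
  numbered from 1; \<open>layer B l\<close> is irrelevant unless \<open>1 \<le> l \<le> depth B\<close>.
\<close>

record ('x, 'k, 'p) base_model =
  depth :: nat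
  input_stage :: "'x \<Rightarrow> ('k, 'p, real mat) prog"
  layer :: "nat \<Rightarrow> real mat \<Rightarrow> ('k, 'p, real mat) prog"
  output_stage :: "real mat \<Rightarrow> ('k, 'p, real vec) prog"

definition decoder_model :: "'k config \<Rightarrow> nat \<Rightarrow> nat \<Rightarrow> ('x, 'k, 'p) base_model \<Rightarrow> bool" where
  "decoder_model K d L B \<longleftrightarrow>
     depth B = L \<and>
     (\<forall>x. \<exists>n. result K (input_stage B x) \<in> carrier_mat n d) \<and>
     (\<forall>l\<in>{1..L}. \<forall>n. \<forall>h\<in>carrier_mat n d. result K (layer B l h) \<in> carrier_mat n d)"

primrec base_hidden :: "('x, 'k, 'p) base_model \<Rightarrow> 'x \<Rightarrow> nat \<Rightarrow> ('k, 'p, real mat) prog" where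
  "base_hidden B x 0 = input_stage B x"
| "base_hidden B x (Suc l) = base_hidden B x l \<rhd> layer B (Suc l)"

definition f_base :: "('x, 'k, 'p) base_model \<Rightarrow> 'x \<Rightarrow> ('k, 'p, real vec) prog" where
  "f_base B x = base_hidden B x (depth B) \<rhd> output_stage B"


section \<open>Adapters, packs and hooks\<close>

text \<open>The LayerNorm gain and bias are stored as \<open>1 \<times> d\<close> matrices.\<close>

record 'p adapter =
  ln_eps :: real
  ln_gain :: "'p weight"
  ln_bias :: "'p weight"
  down :: "'p weight"
  up :: "'p weight"

definition bottleneck_adapter :: "nat \<Rightarrow> nat \<Rightarrow> 'p adapter \<Rightarrow> bool" where
  "bottleneck_adapter d r A \<longleftrightarrow>
     ln_eps A > 0 \<and>
     snd (ln_gain A) \<in> carrier_mat 1 d \<and>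
     snd (ln_bias A) \<in> carrier_mat 1 d \<and>
     snd (down A) \<in> carrier_mat r d \<and>
     snd (up A) \<in> carrier_mat d r"

definition adapter_prog :: "'p adapter \<Rightarrow> real mat \<Rightarrow> ('k, 'p, real mat) prog" where
  "adapter_prog A h =
     call (LayerNorm (ln_eps A)) [Weight (ln_gain A), Weight (ln_bias A), Activation h] \<rhd>
     (\<lambda>u. call Linear [Weight (down A), Activation u] \<rhd>
     (\<lambda>v. call SiLU [Activation v] \<rhd>
     (\<lambda>w. call Linear [Weight (up A), Activation w])))"

text \<open>Gate value 1 is \<open>True\<close>, gate value 0 is \<open>False\<close>.\<close>

record ('x, 'p) pack =
  gate :: "'x \<Rightarrow> bool"
  pack_adapter :: "nat \<Rightarrow> 'p adapter"

definition adapter_pack :: "nat \<Rightarrow> nat \<Rightarrow> ('x, 'p) pack \<Rightarrow> bool" where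
  "adapter_pack d L m \<longleftrightarrow> (\<forall>l\<in>{1..L}. \<exists>r. bottleneck_adapter d r (pack_adapter m l))"

definition hook :: "('x, 'p) pack \<Rightarrow> 'x \<Rightarrow> nat \<Rightarrow> real mat \<Rightarrow> ('k, 'p, real mat) prog" where
  "hook m x l h =
     (if gate m x
      then adapter_prog (pack_adapter m l) h \<rhd> (\<lambda>a. call Add [Activation h, Activation a])
      else Return h)"

primrec hooks :: "('x, 'p) pack list \<Rightarrow> 'x \<Rightarrow> nat \<Rightarrow> real mat \<Rightarrow> ('k, 'p, real mat) prog" where
  "hooks [] x l h = Return h"
| "hooks (m # ms) x l h = hook m x l h \<rhd> hooks ms x l"

primrec attached_hidden ::
  "('x, 'k, 'p) base_model \<Rightarrow> ('x, 'p) pack list \<Rightarrow> 'x \<Rightarrow> nat \<Rightarrow> ('k, 'p, real mat) prog" where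
  "attached_hidden B ms x 0 = input_stage B x"
| "attached_hidden B ms x (Suc l) =
     attached_hidden B ms x l \<rhd> layer B (Suc l) \<rhd> hooks ms x (Suc l)"

definition attach ::
  "('x, 'k, 'p) base_model \<Rightarrow> ('x, 'p) pack list \<Rightarrow> 'x \<Rightarrow> ('k, 'p, real vec) prog" where
  "attach B ms x = attached_hidden B ms x (depth B) \<rhd> output_stage B"


section \<open>Exact arithmetic\<close>

text \<open>
  Under exact real arithmetic the adapter program computes
  \<open>W_up \<sigma>(W_down LN(v))\<close> on each row \<open>v\<close> of the hidden states.
\<close>

definition silu :: "real \<Rightarrow> real" where
  "silu t = t / (1 + exp (- t))"

definition layer_norm :: "real \<Rightarrow> real vec \<Rightarrow> real vec \<Rightarrow> real vec \<Rightarrow> real vec" where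
  "layer_norm \<epsilon> \<gamma> \<beta> v =
     (let d = dim_vec v;
          \<mu> = (\<Sum>i<d. v $ i) / real d;
          s = (\<Sum>i<d. (v $ i - \<mu>)\<^sup>2) / real d
      in vec d (\<lambda>i. \<gamma> $ i * ((v $ i - \<mu>) / sqrt (s + \<epsilon>)) + \<beta> $ i))"

definition map_rows :: "nat \<Rightarrow> (real vec \<Rightarrow> real vec) \<Rightarrow> real mat \<Rightarrow> real mat" where
  "map_rows c f h = mat_of_rows c (map f (rows h))"

definition adapter_map :: "'p adapter \<Rightarrow> real mat \<Rightarrow> real mat" where
  "adapter_map A h =
     map_rows (dim_row (snd (up A)))
       (\<lambda>v. snd (up A) *\<^sub>v map_vec silu (snd (down A) *\<^sub>v
              layer_norm (ln_eps A) (row (snd (ln_gain A)) 0) (row (snd (ln_bias A)) 0) v)) h"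

primrec exact :: "('k \<Rightarrow> real mat list \<Rightarrow> real mat) \<Rightarrow> 'k config" where
  "exact E (LayerNorm \<epsilon>) vs =
     map_rows (dim_col (vs ! 2)) (layer_norm \<epsilon> (row (vs ! 0) 0) (row (vs ! 1) 0)) (vs ! 2)"
| "exact E Linear vs = map_rows (dim_row (vs ! 0)) (\<lambda>v. vs ! 0 *\<^sub>v v) (vs ! 1)"
| "exact E SiLU vs = map_mat silu (vs ! 0)"
| "exact E Add vs = vs ! 0 + vs ! 1"
| "exact E (Other c) vs = E c vs"

lemma map_rows_comp:
  assumes "\<And>v. v \<in> set (rows h) \<Longrightarrow> f v \<in> carrier_vec c"
  shows "map_rows e g (map_rows c f h) = map_rows e (\<lambda>v. g (f v)) h"
proof -
  have "rows (map_rows c f h) = map f (rows h)"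
    unfolding map_rows_def by (rule rows_mat_of_rows) (auto dest: assms)
  then show ?thesis by (simp add: map_rows_def o_def)
qed

lemma map_mat_map_rows:
  assumes "\<And>v. f v \<in> carrier_vec c"
  shows "map_mat s (map_rows c f h) = map_rows c (\<lambda>v. map_vec s (f v)) h"
proof (rule eq_matI)
  fix i j assume "i < dim_row (map_rows c (\<lambda>v. map_vec s (f v)) h)"
    and "j < dim_col (map_rows c (\<lambda>v. map_vec s (f v)) h)"
  then have "i < length (rows h)" "j < c" by (simp_all add: map_rows_def)
  then show "map_mat s (map_rows c f h) $$ (i, j) =
      map_rows c (\<lambda>v. map_vec s (f v)) h $$ (i, j)"
    using carrier_vecD[OF assms, of "rows h ! i"]
    by (simp add: map_rows_def mat_of_rows_index del: length_rows)
qed (simp_all add: map_rows_def)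

lemma result_adapter_prog_exact:
  assumes "bottleneck_adapter d r A" "h \<in> carrier_mat n d"
  shows "result (exact E) (adapter_prog A h) = adapter_map A h"
proof -
  let ?W = "snd (down A)" and ?U = "snd (up A)"
  let ?ln = "layer_norm (ln_eps A) (row (snd (ln_gain A)) 0) (row (snd (ln_bias A)) 0)"
  have ln: "?ln v \<in> carrier_vec d" if "v \<in> set (rows h)" for v
    proof -
    from that assms(2) have "dim_vec v = d" by (auto simp: rows_def)
    then show ?thesis by (simp only: layer_norm_def Let_def vec_carrier)
  qed
  have W: "?W *\<^sub>v ?ln v \<in> carrier_vec (dim_row ?W)" for v
    by (rule carrier_vecI) (rule dim_mult_mat_vec)
  have "result (exact E) (adapter_prog A h) =
      map_rows (dim_row ?U) (\<lambda>v. ?U *\<^sub>v v) (map_mat silu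
        (map_rows (dim_row ?W) (\<lambda>v. ?W *\<^sub>v v) (map_rows d ?ln h)))"
    using carrier_matD(2)[OF assms(2)]
    by (simp only: adapter_prog_def call_def and_then.simps result.simps perform.simps list.map
      operand_value.simps exact.simps nth_Cons_0 nth_Cons_Suc numeral_2_eq_2 One_nat_def)
  also have "map_rows (dim_row ?W) (\<lambda>v. ?W *\<^sub>v v) (map_rows d ?ln h) =
      map_rows (dim_row ?W) (\<lambda>v. ?W *\<^sub>v ?ln v) h"
    by (rule map_rows_comp[OF ln])
  also have "map_mat silu (map_rows (dim_row ?W) (\<lambda>v. ?W *\<^sub>v ?ln v) h) =
      map_rows (dim_row ?W) (\<lambda>v. map_vec silu (?W *\<^sub>v ?ln v)) h"
    by (rule map_mat_map_rows[OF W])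
  also have "map_rows (dim_row ?U) (\<lambda>v. ?U *\<^sub>v v) \<dots> = adapter_map A h"
    unfolding adapter_map_def by (rule map_rows_comp) (use W in simp)
  finally show ?thesis .
qed

lemma result_and_then: "result K (p \<rhd> f) = result K (f (result K p))"
  by (induction p) auto

lemma result_hook_exact:
  assumes "bottleneck_adapter d r (pack_adapter m l)" "h \<in> carrier_mat n d"
  shows "result (exact E) (hook m x l h) =
    (if gate m x then h + adapter_map (pack_adapter m l) h else h)"
  using result_adapter_prog_exact[OF assms, of E] by (simp add: hook_def result_and_then call_def)

end

theory Submission imports Defs begin

text \<open>
  A hook whose gate is closed is the program \<open>Return\<close>, which is a unit for sequencing. So on an
  input that closes all gates, the attached model and the base model are the same program, not
  merely programs with the same operations and result.
\<close>

text \<open>The left unit law is a defining equation of \<open>\<rhd>\<close>; the right one needs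
  induction on \<open>p\<close>.\<close>

lemma and_then_Return: "p \<rhd> Return = p"
  by (induction p) auto

text \<open>An equation between functions, without an argument \<open>h\<close>, because
  \<open>attached_hidden\<close> hands \<open>hooks ms x (Suc l)\<close> unapplied to
  \<open>\<rhd>\<close>.\<close>

lemma hooks_closed:
  assumes "\<And>m. m \<in> set ms \<Longrightarrow> \<not> gate m x"
  shows "hooks ms x l = Return"
proof
  fix h
  show "hooks ms x l h = Return h"
    using assms by (induction ms) (auto simp: hook_def)
qed

lemma attached_hidden_closed:
  assumes "\<And>m. m \<in> set ms \<Longrightarrow> \<not> gate m x"
  shows "attached_hidden B ms x l = base_hidden B x l"
  by (induction l) (simp_all add: hooks_closed[OF assms] and_then_Return)

lemma attach_closed:
  assumes "\<And>m. m \<in> set ms \<Longrightarrow> \<not> gate m x"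
  shows "attach B ms x = f_base B x"
  by (simp add: attach_def f_base_def attached_hidden_closed[OF assms])

theorem proposition1:
  fixes K :: "'k config"
    and d L :: nat
    and B :: "('x, 'k, 'p) base_model"
    and M :: "'m set"
    and pack :: "'m \<Rightarrow> ('x, 'p) pack"
    and reg :: "'m list"
    and f :: "'x \<Rightarrow> ('k, 'p, real vec) prog"
  assumes "decoder_model K d L B"
    and "finite M"
    and "\<forall>m\<in>M. adapter_pack d L (pack m)"
    and "distinct reg" and "set reg = M"
    and "f = attach B (map pack reg)"
  shows "\<forall>x. (\<forall>m\<in>M. \<not> gate (pack m) x) \<longrightarrow>
           operations K (f x) = operations K (f_base B x) \<and>
           result K (f x) = result K (f_base B x)"
proof (intro allI impI)
  fix x
  assume "\<forall>m\<in>M. \<not> gate (pack m) x"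
  \<comment> \<open>The registration order is irrelevant here: \<open>attach_closed\<close> asks
    only about the set of attached packs.\<close>
  with \<open>set reg = M\<close> have "attach B (map pack reg) x = f_base B x"
    by (intro attach_closed) auto
  with \<open>f = attach B (map pack reg)\<close>
  show "operations K (f x) = operations K (f_base B x) \<and>
        result K (f x) = result K (f_base B x)"
    by simp
qed

end
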